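(* Let $n\ge 2$, let $A=(a_{i,j})$ be a real symmetric $n\times n$ matrix, and let $\alpha>0$. For small $t>0$ let $\widetilde A=\widetilde A(t)$ be a real symmetric $(n+1)\times(n+1)$ matrix with entries $\widetilde a_{i,j}$ satisfying: $\widetilde a_{i,j}=a_{i,j}$ for $1\le i,j\le n-1$; $\widetilde a_{i,n}=\widetilde a_{n,i}=a_{i,n}+O(t)$ for $1\le i\le n-1$; $\widetilde a_{i,n+1}=\widetilde a_{n+1,i}=0$ for $1\le i\le n-1$; $\widetilde a_{n,n}=a_{n,n}+\frac{t^{-1}}{\alpha}\bigl(1-\frac{t}{\alpha}+O(t^2)\bigr)$; $\widetilde a_{n,n+1}=\widetilde a_{n+1,n}=-\frac{t^{-3/2}}{\sqrt\alpha}\bigl(1-\frac{t}{2\alpha}+O(t^2)\bigr)$; and $\widetilde a_{n+1,n+1}=t^{-2}$. Here $O(t^k)$ denotes a function of $t$ bounded in absolute value by $Ct^k$ for some constant $C$ and all sufficiently small $t>0$. Then as $t\to0^+$: (i) the largest eigenvalue of $\widetilde A$ diverges to $+\infty$; (ii) the other $n$ eigenvalues of $\widetilde A$ (in increasing order, with multiplicity) converge to the $n$ eigenvalues of $A$ (in increasing order, with multiplicity). *)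

theory Defs
  imports
    Complex_Main
    "HOL-Library.Landau_Symbols"
    "Jordan_Normal_Form.Char_Poly"
begin

text \<open>Only real roots of the characteristic polynomial are listed; for a real symmetric matrix
  these are all of its roots, see \<open>length_eigvals\<close> below.\<close>

definition eigvals :: "real mat \<Rightarrow> real list" where
  "eigvals A = sorted_list_of_multiset (proots (char_poly A))"

lemma set_eigvals:
  assumes A: "A \<in> carrier_mat n n"
  shows "set (eigvals A) = {x. eigenvalue A x}"
proof -
  have "char_poly A \<noteq> 0"
    using degree_monic_char_poly[OF A] by auto
  then show ?thesis
    by (simp add: eigvals_def eigenvalue_root_char_poly[OF A])
qed

lemma eigenvalue_symmetric_real:
  fixes A :: "real mat" and z :: complex
  assumes A: "A \<in> carrier_mat n n" and sym: "transpose_mat A = A"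
    and ev: "eigenvalue (map_mat of_real A) z"
  shows "z \<in> \<real>"
proof -
  let ?B = "map_mat of_real A :: complex mat"
  from ev A obtain v where v: "v \<in> carrier_vec n" "v \<noteq> 0\<^sub>v n" "?B *\<^sub>v v = z \<cdot>\<^sub>v v"
    unfolding eigenvalue_def eigenvector_def by auto
  have s: "A $$ (i,j) = A $$ (j,i)" if "i < n" "j < n" for i j
    using sym A that by (metis carrier_matD index_transpose_mat(1))
  have row: "(\<Sum>j<n. of_real (A $$ (i,j)) * v $ j) = z * v $ i" if "i < n" for i
  proof -
    have "(?B *\<^sub>v v) $ i = (\<Sum>j<n. of_real (A $$ (i,j)) * v $ j)"
      using A v(1) that by (auto simp: scalar_prod_def atLeast0LessThan intro!: sum.cong)
    then show ?thesis using v that by auto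
  qed
  define N where "N = (\<Sum>i<n. v $ i * cnj (v $ i))"
  have N: "N = of_real (\<Sum>i<n. (cmod (v $ i))\<^sup>2)"
    unfolding N_def of_real_sum by (intro sum.cong refl) (rule complex_norm_square[symmetric])
  obtain k where k: "k < n" "v $ k \<noteq> 0"
    using v by (metis carrier_vecD eq_vecI index_zero_vec(1) index_zero_vec(2))
  have "(\<Sum>i<n. (cmod (v $ i))\<^sup>2) > 0"
    by (rule sum_pos2[where i = k]) (use k in auto)
  then have N0: "N \<noteq> 0" unfolding N by (simp only: of_real_eq_0_iff)
  have "z * N = (\<Sum>i<n. \<Sum>j<n. of_real (A $$ (i,j)) * v $ j * cnj (v $ i))"
    unfolding N_def sum_distrib_left
    by (intro sum.cong) (auto simp: row[symmetric] sum_distrib_right mult.assoc[symmetric])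
  also have "\<dots> = (\<Sum>j<n. \<Sum>i<n. of_real (A $$ (i,j)) * v $ j * cnj (v $ i))"
    by (rule sum.swap)
  also have "\<dots> = (\<Sum>j<n. v $ j * cnj (\<Sum>i<n. of_real (A $$ (j,i)) * v $ i))"
    by (intro sum.cong refl) (auto simp: sum_distrib_left s mult_ac intro!: sum.cong)
  also have "\<dots> = (\<Sum>j<n. v $ j * cnj (z * v $ j))"
    by (intro sum.cong refl) (simp only: row lessThan_iff)
  also have "\<dots> = cnj z * N"
    unfolding N_def sum_distrib_left by (simp add: mult_ac)
  finally have "z = cnj z" using N0 by simp
  then show ?thesis by (simp add: Reals_cnj_iff)
qed

lemma length_eigvals:
  assumes A: "A \<in> carrier_mat n n" and sym: "transpose_mat A = A"
  shows "length (eigvals A) = n"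
proof -
  let ?B = "map_mat of_real A :: complex mat"
  have B: "?B \<in> carrier_mat n n" using A by simp
  from char_poly_factorized[OF B] obtain as where
    as: "char_poly ?B = (\<Prod>a\<leftarrow>as. [:- a, 1:])" "length as = n" by auto
  have "a \<in> \<real>" if "a \<in> set as" for a
  proof (rule eigenvalue_symmetric_real[OF A sym])
    show "eigenvalue ?B a"
      unfolding eigenvalue_root_char_poly[OF B] as(1) using that
      by (auto simp: poly_prod_list prod_list_zero_iff)
  qed
  then have eq: "as = map of_real (map Re as)"
    by (auto simp: map_idI complex_is_Real_iff complex_eq_iff intro!: map_idI[symmetric])
  define bs where "bs = map Re as"
  interpret polyhom: map_poly_inj_idom_hom "of_real :: real \<Rightarrow> complex" ..
  have "map_poly of_real (char_poly A) = char_poly ?B"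
    by (simp add: of_real_hom.char_poly_hom[OF A])
  also have "\<dots> = map_poly complex_of_real (\<Prod>b\<leftarrow>bs. [:- b, 1:])"
    unfolding as(1) by (subst eq) (simp add: bs_def[symmetric] polyhom.hom_prod_list o_def)
  finally have cp: "char_poly A = (\<Prod>b\<leftarrow>bs. [:- b, 1:])"
    by (simp only: polyhom.eq_iff)
  have "proots (\<Prod>b\<leftarrow>bs. [:- b, 1:]) = mset bs"
  proof (induction bs)
    case (Cons b bs)
    have nz: "(\<Prod>b\<leftarrow>bs. [:- b, 1:]) \<noteq> 0" by (auto simp: prod_list_zero_iff)
    then show ?case using Cons by (simp add: proots_mult del: mult_pCons_left)
  qed simp
  then have "mset (eigvals A) = mset bs"
    unfolding eigvals_def cp by simp
  then have "length (eigvals A) = length bs" by (rule mset_eq_length)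
  then show ?thesis using as(2) by (simp add: bs_def)
qed

end

theory Submission
  imports Defs "HOL-Library.Extended_Real"
begin

text \<open>Eliminating the last row and column of \<open>x I - At t\<close> gives
  \<open>- t\<^sup>2 \<cdot> char_poly (At t) x = (1 - t\<^sup>2 x) \<cdot> det S\<close>, where the divergent parts cancel in the Schur
  complement \<open>S\<close>, which tends entrywise to \<open>x I - A\<close>. So the real-rooted polynomials
  \<open>P\<^sub>t = - t\<^sup>2 \<cdot> char_poly (At t)\<close> of degree \<open>n + 1\<close> converge pointwise to \<open>char_poly A\<close>, of degree \<open>n\<close>.
  As \<open>P\<^sub>t\<close> has negative leading coefficient but a positive limit at every large point, its largest
  root escapes to infinity. Along a subsequence all roots of \<open>P\<^sub>t\<close> converge in the extended reals;
  in \<open>P\<^sub>t(x) / P\<^sub>t(y)\<close> the roots with infinite limit contribute a factor tending to 1, so the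
  finite limits are exactly the roots of \<open>char_poly A\<close>, with multiplicity.\<close>

section \<open>Eigenvalues as sorted roots of the characteristic polynomial\<close>

text \<open>Splitting off one linear factor lowers both the degree and the number of roots by one,
  so the hypotheses pass to the quotient and induction applies.\<close>

lemma monic_eq_prod_mset_proots:
  fixes p :: "'a :: idom poly"
  assumes "lead_coeff p = 1" "size (proots p) = degree p"
  shows "p = (\<Prod>a\<in>#proots p. [:-a, 1:])"
  using assms
proof (induction "degree p" arbitrary: p)
  case 0
  then obtain c where "p = [:c:]" by (metis degree_eq_zeroE)
  with 0 show ?case by simp
next
  case (Suc m)
  then have "proots p \<noteq> {#}" by (metis Zero_not_Suc size_empty)
  then obtain a where "a \<in># proots p" by blast
  moreover from Suc have p0: "p \<noteq> 0" by auto
  ultimately have "poly p a = 0" by simp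
  then obtain q where q: "p = [:-a, 1:] * q" by (metis dvdE poly_eq_0_iff_dvd)
  with p0 have q0: "q \<noteq> 0" by auto
  have deg: "degree p = Suc (degree q)" unfolding q by (subst degree_mult_eq) (use q0 in auto)
  have pr: "proots p = {#a#} + proots q" unfolding q by (subst proots_mult) (use q0 in auto)
  have lc: "lead_coeff q = 1"
    using Suc.prems(1) unfolding q by (subst (asm) lead_coeff_mult) simp
  have "q = (\<Prod>a\<in>#proots q. [:-a, 1:])"
    using Suc.hyps Suc.prems deg pr lc by (intro Suc.hyps(1)) auto
  then show ?case by (subst q) (simp only: pr, simp)
qed

text \<open>Symmetry enters through \<open>length_eigvals\<close>: there are as many real roots,
  with multiplicity, as the degree, so the monic polynomial splits completely.\<close>

lemma poly_char_poly_eq_prod_eigvals: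
  assumes A: "A \<in> carrier_mat n n" and sym: "transpose_mat A = A"
  shows "poly (char_poly A) x = (\<Prod>i<n. x - eigvals A ! i)"
proof -
  have len: "length (eigvals A) = n" by (rule length_eigvals[OF A sym])
  have ms: "mset (eigvals A) = proots (char_poly A)" by (simp add: eigvals_def)
  have "size (proots (char_poly A)) = n" by (metis len ms size_mset)
  with degree_monic_char_poly[OF A]
  have "char_poly A = (\<Prod>a\<in>#proots (char_poly A). [:-a, 1:])"
    by (intro monic_eq_prod_mset_proots) auto
  also have "\<dots> = (\<Prod>a\<leftarrow>eigvals A. [:-a, 1:])"
    by (simp flip: ms mset_map add: prod_mset_prod_list)
  finally have "poly (char_poly A) x = (\<Prod>a\<leftarrow>eigvals A. x - a)"
    by (simp add: poly_prod_list o_def)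
  also have "\<dots> = (\<Prod>i<n. x - eigvals A ! i)"
    by (simp add: prod.list_conv_set_nth len atLeast0LessThan)
  finally show ?thesis .
qed

lemma mono_on_eigvals:
  assumes "A \<in> carrier_mat n n" "transpose_mat A = A"
  shows "mono_on {..<n} ((!) (eigvals A))"
  using length_eigvals[OF assms]
  by (intro mono_onI) (auto simp: eigvals_def intro!: sorted_nth_mono)

text \<open>A polynomial determines the multiset of its roots, and a multiset has only one sorted
  enumeration. This turns equality of polynomials into equality of eigenvalues index by
  index.\<close>

lemma sorted_roots_unique:
  fixes f g :: "nat \<Rightarrow> 'a :: {idom, linorder}"
  assumes f: "mono_on {..<n} f" and g: "mono_on {..<n} g"
    and eq: "(\<Prod>i<n. [:- f i, 1:]) = (\<Prod>i<n. [:- g i, 1:])" and k: "k < n"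
  shows "f k = g k"
proof -
  have pr: "proots (\<Prod>i<n. [:- h i, 1:]) = mset (map h [0..<n])" for h :: "nat \<Rightarrow> 'a"
    by (subst proots_prod) (auto simp: sum_unfold_sum_mset atLeast0LessThan)
  have "sorted (map h [0..<n])" if "mono_on {..<n} h" for h :: "nat \<Rightarrow> 'a"
    using that by (auto simp: sorted_iff_nth_mono mono_on_def)
  with f g have "map f [0..<n] = map g [0..<n]"
    using eq pr[of f] pr[of g] properties_for_sort by metis
  with k show ?thesis by simp
qed

section \<open>Compactness and subsequences\<close>

text \<open>The extended reals are compact; each induction step thins the subsequence once more to
  make one further coordinate converge.\<close>

lemma ex_subseq_tendsto_ereal:
  fixes X :: "nat \<Rightarrow> nat \<Rightarrow> ereal"
  shows "\<exists>s l. strict_mono s \<and> (\<forall>i<m. (\<lambda>j. X (s j) i) \<longlonglongrightarrow> l i)"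
proof (induction m)
  case 0
  show ?case by (auto intro!: exI[of _ id] strict_mono_id)
next
  case (Suc m)
  then obtain s l where s: "strict_mono s" "\<And>i. i < m \<Longrightarrow> (\<lambda>j. X (s j) i) \<longlonglongrightarrow> l i" by blast
  obtain r a where r: "strict_mono r" "((\<lambda>j. X (s j) m) \<circ> r) \<longlonglongrightarrow> a"
    using compact_complete_linorder by blast
  have "(\<lambda>j. X ((s \<circ> r) j) i) \<longlonglongrightarrow> (l(m := a)) i" if "i < Suc m" for i
  proof (cases "i = m")
    case True
    with r show ?thesis by (simp add: o_def)
  next
    case False
    with that have "i < m" by simp
    from LIMSEQ_subseq_LIMSEQ[OF s(2)[OF this] r(1)] False show ?thesis by (simp add: o_def)
  qed
  moreover have "strict_mono (s \<circ> r)" using s r by (simp add: strict_mono_o)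
  ultimately show ?case by blast
qed

text \<open>Otherwise \<open>X\<close> stays outside some neighbourhood of \<open>l\<close> along a
  subsequence, and no further subsequence of that one can tend to \<open>l\<close>.\<close>

lemma LIMSEQ_via_subsequences:
  assumes "\<And>s :: nat \<Rightarrow> nat. strict_mono s \<Longrightarrow> \<exists>r. strict_mono r \<and> (\<lambda>j. X (s (r j))) \<longlonglongrightarrow> l"
  shows "X \<longlonglongrightarrow> l"
proof (rule topological_tendstoI, rule ccontr)
  fix S assume S: "open S" "l \<in> S" "\<not> (\<forall>\<^sub>F j in sequentially. X j \<in> S)"
  then obtain s :: "nat \<Rightarrow> nat" where s: "strict_mono s" "\<And>j. X (s j) \<notin> S"
    using not_eventually_sequentiallyD by blast
  then obtain r where "(\<lambda>j. X (s (r j))) \<longlonglongrightarrow> l" using assms by blast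
  then have "\<forall>\<^sub>F j in sequentially. X (s (r j)) \<in> S" using S topological_tendstoD by blast
  with s show False by simp
qed

section \<open>Roots of real-rooted polynomials whose limit has lower degree\<close>

lemma filterlim_largest_root_at_top:
  fixes L :: "'a \<Rightarrow> nat \<Rightarrow> real"
  assumes c: "\<forall>\<^sub>F t in F. c t < 0"
    and mono: "\<forall>\<^sub>F t in F. mono_on {..n} (L t)"
    and lim: "\<And>x. ((\<lambda>t. c t * (\<Prod>i\<le>n. x - L t i)) \<longlongrightarrow> (\<Prod>i<n. x - \<mu> i)) F"
  shows "filterlim (\<lambda>t. L t n) at_top F"
  unfolding filterlim_at_top
proof
  fix K :: real
  \<comment> \<open>A point at least \<open>K\<close> and beyond every \<open>\<mu> i\<close>, so
    the limit polynomial is positive there. If the largest root stayed below \<open>K\<close>, all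
    factors at \<open>x\<close> would be nonnegative and the negative \<open>c t\<close> would force
    the wrong sign.\<close>
  define x where "x = \<bar>K\<bar> + (\<Sum>i<n. \<bar>\<mu> i\<bar>) + 1"
  have x: "\<mu> i < x" if "i < n" for i
    using member_le_sum[of i "{..<n}" "\<lambda>i. \<bar>\<mu> i\<bar>"] that unfolding x_def by auto
  have Kx: "K \<le> x" unfolding x_def using sum_nonneg[of "{..<n}" "\<lambda>i. \<bar>\<mu> i\<bar>"] by linarith
  have "(\<Prod>i<n. x - \<mu> i) > 0" by (intro prod_pos) (use x in auto)
  with lim have "\<forall>\<^sub>F t in F. c t * (\<Prod>i\<le>n. x - L t i) > 0" by (rule order_tendstoD)
  with c mono show "\<forall>\<^sub>F t in F. K \<le> L t n"
  proof eventually_elim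
    case (elim t)
    show ?case
    proof (rule ccontr)
      assume "\<not> K \<le> L t n"
      then have "L t i \<le> x" if "i \<le> n" for i
        using that Kx mono_onD[OF elim(2), of i n] by auto
      then have "(\<Prod>i\<le>n. x - L t i) \<ge> 0" by (intro prod_nonneg) auto
      with elim show False by (simp add: zero_less_mult_iff)
    qed
  qed
qed

text \<open>The ratio equals \<open>1 + (x - y) / (y - f t)\<close>. This is how escaping roots drop
  out of a quotient of two values of the polynomial.\<close>

lemma tendsto_ratio_shift_1:
  fixes f :: "'a \<Rightarrow> real"
  assumes f: "filterlim f at_infinity F"
  shows "((\<lambda>t. (x - f t) / (y - f t)) \<longlongrightarrow> 1) F"
proof -
  have "filterlim (\<lambda>t. norm (- f t)) at_top F"
    using filterlim_at_infinity_imp_norm_at_top[OF f] by simp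
  then have g: "filterlim (\<lambda>t. y - f t) at_infinity F"
    using tendsto_add_filterlim_at_infinity[OF tendsto_const, of "\<lambda>t. - f t" F y]
    by (simp add: filterlim_norm_at_top_imp_at_infinity)
  have "((\<lambda>t. 1 + (x - y) / (y - f t)) \<longlongrightarrow> 1 + 0) F"
    by (intro tendsto_intros tendsto_divide_0[OF tendsto_const g])
  moreover have "\<forall>\<^sub>F t in F. y - f t \<noteq> 0" 
    using g by (rule filterlim_at_infinity_imp_eventually_ne)
  then have "\<forall>\<^sub>F t in F. 1 + (x - y) / (y - f t) = (x - f t) / (y - f t)"
    by eventually_elim (simp add: field_simps)
  ultimately show ?thesis by (simp add: tendsto_cong)
qed

text \<open>Dividing by the value at a reference point \<open>y\<close> cancels the unknown factor
  \<open>c\<close>. Comparing degrees then shows that exactly \<open>n\<close> of the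
  \<open>n + 1\<close> roots have finite limits along the subsequence; order and multiplicity
  identify these limits.\<close>

lemma ex_subseq_root_tendsto:
  fixes L :: "nat \<Rightarrow> nat \<Rightarrow> real"
  assumes mono: "\<And>j. mono_on {..n} (L j)" and \<mu>: "mono_on {..<n} \<mu>"
    and lim: "\<And>x. (\<lambda>j. c j * (\<Prod>i\<le>n. x - L j i)) \<longlonglongrightarrow> (\<Prod>i<n. x - \<mu> i)"
    and top: "filterlim (\<lambda>j. L j n) at_top sequentially" and k: "k < n"
  shows "\<exists>s. strict_mono s \<and> (\<lambda>j. L (s j) k) \<longlonglongrightarrow> \<mu> k"
proof -
  obtain s l where s: "strict_mono s"
    and l: "\<And>i. i < Suc n \<Longrightarrow> (\<lambda>j. ereal (L (s j) i)) \<longlonglongrightarrow> l i"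
    using ex_subseq_tendsto_ereal[of "Suc n" "\<lambda>j i. ereal (L j i)"] by blast
  define F where "F = {i. i \<le> n \<and> \<bar>l i\<bar> \<noteq> \<infinity>}"
  \<comment> \<open>\<open>real_of_ereal\<close> sends infinite values to 0, so \<open>m i\<close>
    is the limit of a root only for \<open>i\<close> in \<open>F\<close>.\<close>
  define m where "m i = real_of_ereal (l i)" for i
  have finF: "finite F" unfolding F_def by simp
  have LF: "(\<lambda>j. L (s j) i) \<longlonglongrightarrow> m i" if "i \<in> F" for i
  proof -
    from that have "i < Suc n" "l i = ereal (m i)" by (auto simp: F_def m_def ereal_real')
    with l[of i] show ?thesis by simp
  qed
  \<comment> \<open>Both signs of infinity are treated alike; escape to minus infinity is excluded
    later by counting degrees.\<close>
  have LI: "filterlim (\<lambda>j. L (s j) i) at_infinity sequentially" if "i \<le> n" "i \<notin> F" for i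
  proof -
    from that have "l i = \<infinity> \<or> l i = -\<infinity>" by (auto simp: F_def)
    then have "filterlim (\<lambda>j. L (s j) i) at_top sequentially \<or>
        filterlim (\<lambda>j. L (s j) i) at_bot sequentially"
      using l[of i] that
      by (auto simp: tendsto_PInfty tendsto_MInfty filterlim_at_top_dense filterlim_at_bot_dense)
    then show ?thesis
      by (metis at_bot_le_at_infinity at_top_le_at_infinity filterlim_mono order_refl)
  qed
  \<comment> \<open>Avoiding the finite limits and the \<open>\<mu> i\<close> keeps both limiting
    denominators \<open>D\<close> and \<open>E\<close> nonzero.\<close>
  obtain y where y: "y \<notin> m ` F \<union> \<mu> ` {..<n}"
    using ex_new_if_finite[of "m ` F \<union> \<mu> ` {..<n}"] finF infinite_UNIV_char_0 by blast
  define D where "D = (\<Prod>i<n. y - \<mu> i)"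
  define E where "E = (\<Prod>i\<in>F. y - m i)"
  have D: "D \<noteq> 0" and E: "E \<noteq> 0" using y finF by (auto simp: D_def E_def)
  have lim_s: "(\<lambda>j. c (s j) * (\<Prod>i\<le>n. x - L (s j) i)) \<longlonglongrightarrow> (\<Prod>i<n. x - \<mu> i)" for x
    using LIMSEQ_subseq_LIMSEQ[OF lim s] by (simp add: o_def)
  \<comment> \<open>Both sides are limits of one quotient: the left by \<open>lim_s\<close>, the
    right factor by factor, the factors outside \<open>F\<close> tending to 1.\<close>
  have "(\<Prod>i<n. x - \<mu> i) / D = (\<Prod>i\<in>F. x - m i) / E" for x
  proof (rule LIMSEQ_unique)
    have "(\<lambda>j. (c (s j) * (\<Prod>i\<le>n. x - L (s j) i)) / (c (s j) * (\<Prod>i\<le>n. y - L (s j) i))) \<longlonglongrightarrow> 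
        (\<Prod>i<n. x - \<mu> i) / D"
      using lim_s[of x] lim_s[of y] D unfolding D_def by (intro tendsto_divide)
    moreover have "\<forall>\<^sub>F j in sequentially. c (s j) * (\<Prod>i\<le>n. y - L (s j) i) \<noteq> 0"
      using lim_s[of y] D unfolding D_def by (rule tendsto_imp_eventually_ne)
    then have "\<forall>\<^sub>F j in sequentially. (c (s j) * (\<Prod>i\<le>n. x - L (s j) i)) / (c (s j) * (\<Prod>i\<le>n. y - L (s j) i))
        = (\<Prod>i\<le>n. (x - L (s j) i) / (y - L (s j) i))"
      by eventually_elim (auto simp: prod_dividef)
    ultimately show "(\<lambda>j. \<Prod>i\<le>n. (x - L (s j) i) / (y - L (s j) i)) \<longlonglongrightarrow> (\<Prod>i<n. x - \<mu> i) / D"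
      by (simp add: tendsto_cong)
    have "(\<lambda>j. \<Prod>i\<le>n. (x - L (s j) i) / (y - L (s j) i)) \<longlonglongrightarrow>
        (\<Prod>i\<le>n. if i \<in> F then (x - m i) / (y - m i) else 1)"
    proof (rule tendsto_prod)
      fix i assume "i \<in> {..n}"
      then show "(\<lambda>j. (x - L (s j) i) / (y - L (s j) i)) \<longlonglongrightarrow> (if i \<in> F then (x - m i) / (y - m i) else 1)"
        using LF LI y by (auto intro!: tendsto_ratio_shift_1 tendsto_intros)
    qed
    also have "(\<Prod>i\<le>n. if i \<in> F then (x - m i) / (y - m i) else 1) = (\<Prod>i\<in>F. (x - m i) / (y - m i))"
      by (simp add: prod.If_cases F_def) (intro prod.cong; auto)
    also have "\<dots> = (\<Prod>i\<in>F. x - m i) / E" by (simp add: E_def prod_dividef)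
    finally show "(\<lambda>j. \<Prod>i\<le>n. (x - L (s j) i) / (y - L (s j) i)) \<longlonglongrightarrow> (\<Prod>i\<in>F. x - m i) / E" .
  qed
  \<comment> \<open>Equality at every point gives equality of polynomials, so degrees and leading
    coefficients can be compared.\<close>
  then have eq: "Polynomial.smult E (\<Prod>i<n. [:- \<mu> i, 1:]) = Polynomial.smult D (\<Prod>i\<in>F. [:- m i, 1:])"
    using D E by (simp flip: poly_eq_poly_eq_iff add: fun_eq_iff poly_prod field_simps)
  have deg: "degree (\<Prod>i\<in>I. [:- f i, 1:]) = card I" for f :: "nat \<Rightarrow> real" and I
    by (subst degree_prod_eq_sum_degree) auto
  have lc: "lead_coeff (\<Prod>i\<in>I. [:- f i, 1:]) = 1" for f :: "nat \<Rightarrow> real" and I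
    by (simp add: lead_coeff_prod)
  from arg_cong[OF eq, of degree] D E have card: "card F = n" by (simp add: deg)
  have "E = D" using arg_cong[OF eq, of lead_coeff] by (simp only: lead_coeff_smult lc)
  \<comment> \<open>The last root escapes, so the \<open>n\<close> elements of \<open>F\<close> must
    be exactly the indices below \<open>n\<close>.\<close>
  have "l n = \<infinity>"
  proof (rule LIMSEQ_unique[OF l])
    show "(\<lambda>j. ereal (L (s j) n)) \<longlonglongrightarrow> \<infinity>"
      using filterlim_compose[OF top filterlim_subseq[OF s]] by (simp add: tendsto_PInfty_eq_at_top)
  qed simp
  then have "n \<notin> F" by (simp add: F_def)
  then have "F \<subseteq> {..<n}" unfolding F_def by (auto simp: le_less)
  with card have F: "F = {..<n}" by (intro card_subset_eq) auto
  have "mono_on {..<n} m"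
  proof (rule mono_onI)
    fix i i' assume ii: "i \<in> {..<n}" "i' \<in> {..<n}" "i \<le> i'"
    have "L (s j) i \<le> L (s j) i'" for j by (rule mono_onD[OF mono]) (use ii in auto)
    then show "m i \<le> m i'" using LIMSEQ_le[OF LF[of i] LF[of i']] F ii by blast
  qed
  moreover have "(\<Prod>i<n. [:- m i, 1:]) = (\<Prod>i<n. [:- \<mu> i, 1:])"
    using arg_cong[OF eq, of "Polynomial.smult (1 / D)"] D \<open>E = D\<close> F by simp
  ultimately have "m k = \<mu> k" using \<mu> k by (intro sorted_roots_unique[of n m \<mu> k])
  with LF[of k] k F s show ?thesis by auto
qed

section \<open>Continuity of the determinant and the Schur complement\<close>

text \<open>By the Leibniz formula the determinant is a polynomial in the entries.\<close>

lemma tendsto_det: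
  fixes M :: "'b :: real_normed_field mat"
  assumes N: "\<forall>\<^sub>F t in F. N t \<in> carrier_mat n n" and M: "M \<in> carrier_mat n n"
    and lim: "\<And>i j. i < n \<Longrightarrow> j < n \<Longrightarrow> ((\<lambda>t. N t $$ (i, j)) \<longlongrightarrow> M $$ (i, j)) F"
  shows "((\<lambda>t. det (N t)) \<longlongrightarrow> det M) F"
proof -
  have "((\<lambda>t. \<Sum>p | p permutes {0..<n}. signof p * (\<Prod>i = 0..<n. N t $$ (i, p i))) \<longlongrightarrow> det M) F"
    unfolding det_def'[OF M]
    by (intro tendsto_sum tendsto_mult tendsto_const tendsto_prod lim) (auto dest: permutes_in_image)
  moreover have "\<forall>\<^sub>F t in F. (\<Sum>p | p permutes {0..<n}. signof p * (\<Prod>i = 0..<n. N t $$ (i, p i))) = det (N t)"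
    using N by eventually_elim (simp add: det_def')
  ultimately show ?thesis by (simp add: tendsto_cong)
qed

text \<open>Block elimination: \<open>M\<close> is the product of the upper block triangular
  \<open>?U\<close>, with diagonal blocks \<open>S\<close> and the pivot, and the unipotent lower
  triangular \<open>?V\<close>.\<close>

lemma det_Schur_complement:
  fixes M :: "'a :: field mat"
  assumes M: "M \<in> carrier_mat (Suc n) (Suc n)" and d: "M $$ (n, n) \<noteq> 0"
  shows "det M = M $$ (n, n) * 
    det (mat n n (\<lambda>(i, j). M $$ (i, j) - M $$ (i, n) * M $$ (n, j) / M $$ (n, n)))"
proof -
  define S where "S = mat n n (\<lambda>(i, j). M $$ (i, j) - M $$ (i, n) * M $$ (n, j) / M $$ (n, n))"
  define b where "b = mat n 1 (\<lambda>(i, j). M $$ (i, n))"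
  define c where "c = mat 1 n (\<lambda>(i, j). M $$ (n, j) / M $$ (n, n))"
  define e where "e = mat 1 1 (\<lambda>_. M $$ (n, n))"
  let ?U = "four_block_mat S b (0\<^sub>m 1 n) e" and ?V = "four_block_mat (1\<^sub>m n) (0\<^sub>m n 1) c (1\<^sub>m 1)"
  have cm: "S \<in> carrier_mat n n" "b \<in> carrier_mat n 1" "c \<in> carrier_mat 1 n" "e \<in> carrier_mat 1 1"
    by (auto simp: S_def b_def c_def e_def)
  have "?U * ?V = four_block_mat (S + b * c) b (e * c) e"
    using cm by (subst mult_four_block_mat[OF cm(1,2) _ cm(4) _ _ cm(3)]) auto
  also have "\<dots> = M"
    using M d by (intro eq_matI)
      (auto simp: S_def b_def c_def e_def scalar_prod_def less_Suc_eq)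
  finally have "det M = det (?U * ?V)" by simp
  also have "\<dots> = det ?U * det ?V"
    using cm by (intro det_mult[of _ "n + 1"]) auto
  also have "det ?U = det S * det e"
    using cm by (intro det_four_block_mat_lower_left_zero) auto
  also have "det ?V = 1"
    using cm by (subst det_four_block_mat_upper_right_zero) auto
  also have "det e = M $$ (n, n)" by (simp add: det_single e_def)
  finally show ?thesis by (simp add: S_def mult.commute)
qed

section \<open>Cancellation of the divergent terms in the corner entry\<close>

lemma bigo_square_imp_tendsto_ratio:
  fixes p :: "real \<Rightarrow> real"
  assumes "p \<in> O[at_right 0](\<lambda>t. t^2)"
  shows "((\<lambda>t. p t / t) \<longlongrightarrow> 0) (at_right 0)"
proof -
  have "(\<lambda>t::real. t^2) \<in> o[at_right 0](\<lambda>t. t)"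
  proof (rule smalloI_tendsto)
    have "((\<lambda>t::real. t) \<longlongrightarrow> 0) (at_right 0)" by simp
    then show "((\<lambda>t::real. t^2 / t) \<longlongrightarrow> 0) (at_right 0)"
      by (simp add: power2_eq_square)
  qed (auto simp: eventually_at_filter)
  with assms have "p \<in> o[at_right 0](\<lambda>t. t)" by (rule landau_o.big_small_trans)
  then show ?thesis by (rule smalloD_tendsto)
qed

text \<open>The two divergent terms cancel up to order \<open>t\<close>: with \<open>w = 1 - t / (2\<alpha>) + q\<close>, the sum below is
  \<open>((1 - t / \<alpha> + p) (1 - t\<^sup>2 x) - w\<^sup>2) / (\<alpha> t (1 - t\<^sup>2 x))\<close>, and the numerator is \<open>O(t\<^sup>2)\<close>.\<close>

lemma Schur_corner_tendsto_0:
  fixes p q :: "real \<Rightarrow> real"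
  assumes \<alpha>: "\<alpha> > 0" and p: "p \<in> O[at_right 0](\<lambda>t. t^2)" and q: "q \<in> O[at_right 0](\<lambda>t. t^2)"
  shows "((\<lambda>t. t powr (-1) / \<alpha> * (1 - t / \<alpha> + p t) +
      (- (t powr (-3/2) / sqrt \<alpha>) * (1 - t / (2 * \<alpha>) + q t))^2 / (x - t powr (-2))) \<longlongrightarrow> 0)
    (at_right 0)"
proof -
  have p': "((\<lambda>t. p t / t) \<longlongrightarrow> 0) (at_right 0)" and q': "((\<lambda>t. q t / t) \<longlongrightarrow> 0) (at_right 0)"
    using p q by (auto intro: bigo_square_imp_tendsto_ratio)
  have pos: "\<forall>\<^sub>F t::real in at_right 0. t > 0" by (simp add: eventually_at_filter)
  have id: "((\<lambda>t::real. t) \<longlongrightarrow> 0) (at_right 0)" by simp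
  have drop: "(f \<longlongrightarrow> 0) (at_right 0)" if "((\<lambda>t. f t / t) \<longlongrightarrow> 0) (at_right 0)" for f :: "real \<Rightarrow> real"
  proof (rule Lim_transform_eventually)
    show "((\<lambda>t. f t / t * t) \<longlongrightarrow> 0) (at_right 0)" using tendsto_mult[OF that id] by simp
    show "\<forall>\<^sub>F t in at_right 0. f t / t * t = f t" using pos by eventually_elim simp
  qed
  note lims = p' q' drop[OF p'] drop[OF q'] id
  \<comment> \<open>The quotient described above after expansion: the constant terms and the terms
    \<open>t / \<alpha>\<close> in the numerator have cancelled, and one power of \<open>t\<close>
    has been divided out, so every remaining summand visibly tends to 0.\<close>
  define h where "h t = (p t / t - t * x * (1 - t / \<alpha> + p t) - t / (4 * \<alpha>^2)
    - 2 * (q t / t) * (1 - t / (2 * \<alpha>)) - q t / t * q t) / (\<alpha> * (1 - t^2 * x))" for t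
  have "(h \<longlongrightarrow> (0 - 0 * x * (1 - 0 / \<alpha> + 0) - 0 / (4 * \<alpha>^2)
    - 2 * 0 * (1 - 0 / (2 * \<alpha>)) - 0 * 0) / (\<alpha> * (1 - 0^2 * x))) (at_right 0)"
    unfolding h_def by (intro tendsto_intros lims) (use \<alpha> in auto)
  then have "(h \<longlongrightarrow> 0) (at_right 0)" by simp
  moreover have "((\<lambda>t. 1 - t^2 * x) \<longlongrightarrow> 1 - 0^2 * x) (at_right 0)" by (intro tendsto_intros)
  then have "\<forall>\<^sub>F t in at_right 0. 1 - t^2 * x \<noteq> 0" by (rule tendsto_imp_eventually_ne) simp
  with pos have "\<forall>\<^sub>F t in at_right 0. h t = t powr (-1) / \<alpha> * (1 - t / \<alpha> + p t) +
      (- (t powr (-3/2) / sqrt \<alpha>) * (1 - t / (2 * \<alpha>) + q t))^2 / (x - t powr (-2))"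
  proof eventually_elim
    case (elim t)
    define P where "P = 1 - t / \<alpha> + p t"
    define w where "w = 1 - t / (2 * \<alpha>) + q t"
    define d where "d = 1 - t^2 * x"
    have d: "d \<noteq> 0" using elim by (simp add: d_def)
    have "(t powr (-3/2))^2 = t powr (-3)" using elim by (simp add: power2_eq_square flip: powr_add)
    also have "\<dots> = 1 / t^3" using elim by (simp add: powr_minus_divide powr_numeral)
    finally have b: "(- (t powr (-3/2) / sqrt \<alpha>) * w)^2 = w^2 / (\<alpha> * t^3)"
      using \<alpha> by (simp add: power_mult_distrib power_divide)
    have e: "x - t powr (-2) = - d / t^2"
      using elim by (simp add: d_def powr_minus_divide powr_numeral field_simps)
    have "t powr (-1) / \<alpha> * P + (- (t powr (-3/2) / sqrt \<alpha>) * w)^2 / (x - t powr (-2))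
        = P / (\<alpha> * t) - w^2 / (\<alpha> * t * d)"
      unfolding b e using elim \<alpha> d by (simp add: powr_minus_divide power2_eq_square power3_eq_cube)
    also have "\<dots> = (P * d - w^2) / t / (\<alpha> * d)"
      using elim \<alpha> d by (simp add: field_simps)
    also have "(P * d - w^2) / t = p t / t - t * x * (1 - t / \<alpha> + p t) - t / (4 * \<alpha>^2)
        - 2 * (q t / t) * (1 - t / (2 * \<alpha>)) - q t / t * q t"
      using elim \<alpha> by (simp add: P_def w_def d_def field_simps power2_eq_square)
    finally show ?case by (simp add: h_def P_def w_def d_def)
  qed
  ultimately show ?thesis by (rule Lim_transform_eventually)
qed

section \<open>Convergence of the rescaled characteristic polynomial and of the eigenvalues\<close>

lemma index_uminus_char_matrix:
  assumes "A \<in> carrier_mat n n" "i < n" "j < n"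
  shows "(- char_matrix A x) $$ (i, j) = (if i = j then x else 0) - A $$ (i, j)"
  using assms by (auto simp: char_matrix_def)

text \<open>Indices start at 0: the rows numbered n and n+1 in the informal statement are
  \<open>n-1\<close> and \<open>n\<close>, and index \<open>n\<close> of
  \<open>eigvals (At t)\<close> is the largest eigenvalue.\<close>

theorem proposition3p2:
  fixes n :: nat and A :: "real mat" and \<alpha> :: real
    and At :: "real \<Rightarrow> real mat"
    and r :: "nat \<Rightarrow> real \<Rightarrow> real" and p q :: "real \<Rightarrow> real"
  assumes n: "n \<ge> 2"
    and A: "A \<in> carrier_mat n n" "transpose_mat A = A"
    and \<alpha>: "\<alpha> > 0"
    and At: "\<forall>\<^sub>F t in at_right 0. At t \<in> carrier_mat (n+1) (n+1) \<and> transpose_mat (At t) = At t"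
    and block: "\<forall>\<^sub>F t in at_right 0. \<forall>i<n-1. \<forall>j<n-1. At t $$ (i, j) = A $$ (i, j)"
    and col_n: "\<forall>\<^sub>F t in at_right 0. \<forall>i<n-1. At t $$ (i, n-1) = A $$ (i, n-1) + r i t"
    and r: "\<forall>i<n-1. r i \<in> O[at_right 0](\<lambda>t. t)"
    and col_Suc_n: "\<forall>\<^sub>F t in at_right 0. \<forall>i<n-1. At t $$ (i, n) = 0"
    and diag_n: "\<forall>\<^sub>F t in at_right 0.
          At t $$ (n-1, n-1) = A $$ (n-1, n-1) + t powr (-1) / \<alpha> * (1 - t / \<alpha> + p t)"
    and p: "p \<in> O[at_right 0](\<lambda>t. t^2)"
    and off_diag: "\<forall>\<^sub>F t in at_right 0.
          At t $$ (n-1, n) = - (t powr (-3/2) / sqrt \<alpha>) * (1 - t / (2 * \<alpha>) + q t)"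
    and q: "q \<in> O[at_right 0](\<lambda>t. t^2)"
    and diag_Suc_n: "\<forall>\<^sub>F t in at_right 0. At t $$ (n, n) = t powr (-2)"
  shows "filterlim (\<lambda>t. eigvals (At t) ! n) at_top (at_right 0)
    \<and> (\<forall>k<n. ((\<lambda>t. eigvals (At t) ! k) \<longlongrightarrow> eigvals A ! k) (at_right 0))"
proof -
  let ?F = "at_right (0 :: real)"
  have pos: "\<forall>\<^sub>F t in ?F. t > 0" by (simp add: eventually_at_filter)
  have mono_ev: "\<forall>\<^sub>F t in ?F. mono_on {..n} ((!) (eigvals (At t)))"
    using At by eventually_elim (use mono_on_eigvals[of _ "Suc n"] in \<open>simp add: lessThan_Suc_atMost\<close>)
  have r0: "(r i \<longlongrightarrow> 0) ?F" if "i < n - 1" for i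
  proof -
    have "(\<lambda>t. t) \<in> o[?F](\<lambda>_. 1 :: real)" by (rule smalloI_tendsto) auto
    with r that have "r i \<in> o[?F](\<lambda>_. 1)" by (blast intro: landau_o.big_small_trans)
    then show ?thesis using smalloD_tendsto by force
  qed
  define M where "M x t = - char_matrix (At t) x" for x t
  define S where "S x t = mat n n (\<lambda>(i, j).
    M x t $$ (i, j) - M x t $$ (i, n) * M x t $$ (n, j) / M x t $$ (n, n))" for x t
  \<comment> \<open>Symmetry is recorded too, since the last two columns are prescribed only on and
    above the diagonal.\<close>
  have M_index: "\<forall>\<^sub>F t in ?F. \<forall>i\<le>n. \<forall>j\<le>n. M x t $$ (i, j) = (if i = j then x else 0) - At t $$ (i, j) \<and>
      At t $$ (j, i) = At t $$ (i, j)" for x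
    using At
  proof eventually_elim
    case (elim t)
    then have "At t $$ (j, i) = At t $$ (i, j)" if "i \<le> n" "j \<le> n" for i j
      using that by (metis Suc_eq_plus1 carrier_matD index_transpose_mat(1) le_imp_less_Suc)
    with elim show ?case by (auto simp: M_def index_uminus_char_matrix)
  qed
  have S_lim: "((\<lambda>t. S x t $$ (i, j)) \<longlongrightarrow> (- char_matrix A x) $$ (i, j)) ?F" if ij: "i < n" "j < n" for x i j
  proof -
    define h where "h t = t powr (-1) / \<alpha> * (1 - t / \<alpha> + p t) +
      (- (t powr (-3/2) / sqrt \<alpha>) * (1 - t / (2 * \<alpha>) + q t))^2 / (x - t powr (-2))" for t
    have h0: "(h \<longlongrightarrow> 0) ?F"
      unfolding h_def by (rule Schur_corner_tendsto_0[OF \<alpha> p q])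
    \<comment> \<open>The error \<open>\<rho>\<close> by position: column \<open>n\<close> vanishes
      above row \<open>n-1\<close>, so the Schur correction affects only the corner
      \<open>(n-1, n-1)\<close>; elsewhere the error is 0 or some \<open>r i\<close>.\<close>
    define \<rho> where "\<rho> = (if i < n - 1 then if j < n - 1 then (\<lambda>_. 0) else r i
      else if j < n - 1 then r j else h)"
    have "(\<rho> \<longlongrightarrow> 0) ?F" using r0 h0 by (simp add: \<rho>_def)
    then have "((\<lambda>t. (- char_matrix A x) $$ (i, j) - \<rho> t) \<longlongrightarrow> (- char_matrix A x) $$ (i, j) - 0) ?F"
      by (intro tendsto_intros)
    moreover have "\<forall>\<^sub>F t in ?F. (- char_matrix A x) $$ (i, j) - \<rho> t = S x t $$ (i, j)"
      using M_index[of x] block col_n col_Suc_n diag_n off_diag diag_Suc_n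
    proof eventually_elim
      case (elim t)
      have A_sym: "A $$ (j, i) = A $$ (i, j)"
        using A ij by (metis carrier_matD index_transpose_mat(1))
      have Sij: "S x t $$ (i, j) = (if i = j then x else 0) - At t $$ (i, j)
          - At t $$ (i, n) * At t $$ (j, n) / (x - At t $$ (n, n))"
        using elim(1) ij by (simp add: S_def)
      have Aij: "(- char_matrix A x) $$ (i, j) = (if i = j then x else 0) - A $$ (i, j)"
        using A ij by (simp add: index_uminus_char_matrix)
      consider "i < n - 1" "j < n - 1" | "i < n - 1" "j = n - 1" | "i = n - 1" "j < n - 1"
        | "i = n - 1" "j = n - 1" using ij by linarith
      then show ?case
      proof cases
        case 3
        have "At t $$ (i, j) = At t $$ (j, i)" using elim(1) ij by simp
        with 3 elim A_sym show ?thesis unfolding Sij Aij by (simp add: \<rho>_def)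
      next
        case 4
        with elim show ?thesis unfolding Sij Aij by (simp add: \<rho>_def h_def power2_eq_square)
      next
        case 1
        with elim show ?thesis unfolding Sij Aij by (simp add: \<rho>_def)
      next
        case 2
        with elim show ?thesis unfolding Sij Aij by (simp add: \<rho>_def)
      qed
    qed
    ultimately show ?thesis by (simp add: tendsto_cong)
  qed
  have key: "((\<lambda>t. - (t^2) * poly (char_poly (At t)) x) \<longlongrightarrow> poly (char_poly A) x) ?F" for x
  proof -
    have id: "((\<lambda>t::real. t) \<longlongrightarrow> 0) ?F" by simp
    have d: "((\<lambda>t. 1 - t^2 * x) \<longlongrightarrow> 1 - 0^2 * x) ?F" by (intro tendsto_intros id)
    \<comment> \<open>For fixed \<open>x\<close> this makes the pivot \<open>M x t $$ (n, n)\<close>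
      nonzero for small \<open>t\<close>, as the Schur complement requires.\<close>
    then have ne: "\<forall>\<^sub>F t in ?F. 1 - t^2 * x \<noteq> 0" by (rule tendsto_imp_eventually_ne) simp
    have "((\<lambda>t. det (S x t)) \<longlongrightarrow> det (- char_matrix A x)) ?F"
      by (rule tendsto_det[where n = n]) (use A S_lim in \<open>auto simp: S_def\<close>)
    from tendsto_mult[OF d this]
    have "((\<lambda>t. (1 - t^2 * x) * det (S x t)) \<longlongrightarrow> poly (char_poly A) x) ?F"
      by (simp add: char_poly_matrix[OF A(1)])
    moreover have "\<forall>\<^sub>F t in ?F. (1 - t^2 * x) * det (S x t) = - (t^2) * poly (char_poly (At t)) x"
      using ne pos At M_index[of x] diag_Suc_n
    proof eventually_elim
      case (elim t)
      have "M x t $$ (n, n) = x - t powr (-2)" using elim(4,5) by simp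
      then have Mnn: "M x t $$ (n, n) = - ((1 - t^2 * x) / t^2)"
        using elim(2) by (simp add: powr_minus_divide powr_numeral field_simps)
      have "poly (char_poly (At t)) x = det (M x t)"
        unfolding M_def using elim(3) char_poly_matrix by blast
      also have "\<dots> = M x t $$ (n, n) * det (S x t)"
        unfolding S_def using elim(1-3) by (intro det_Schur_complement) (auto simp: Mnn, simp add: M_def)
      finally show ?case using elim(2) by (simp add: Mnn)
    qed
    ultimately show ?thesis by (rule Lim_transform_eventually)
  qed
  have lim: "((\<lambda>t. - (t^2) * (\<Prod>i\<le>n. x - eigvals (At t) ! i)) \<longlongrightarrow> (\<Prod>i<n. x - eigvals A ! i)) ?F" for x
  proof (rule Lim_transform_eventually)
    show "((\<lambda>t. - (t^2) * poly (char_poly (At t)) x) \<longlongrightarrow> (\<Prod>i<n. x - eigvals A ! i)) ?F"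
      using key[of x] by (simp only: poly_char_poly_eq_prod_eigvals[OF A])
    show "\<forall>\<^sub>F t in ?F. - (t^2) * poly (char_poly (At t)) x = - (t^2) * (\<Prod>i\<le>n. x - eigvals (At t) ! i)"
      using At by eventually_elim (simp add: poly_char_poly_eq_prod_eigvals[of _ "Suc n"] lessThan_Suc_atMost)
  qed
  show ?thesis
  proof (intro conjI allI impI)
    show top: "filterlim (\<lambda>t. eigvals (At t) ! n) at_top ?F"
    proof (rule filterlim_largest_root_at_top[OF _ mono_ev lim])
      show "\<forall>\<^sub>F t in ?F. - (t^2) < 0" using pos by eventually_elim simp
    qed
    fix k assume k: "k < n"
    \<comment> \<open>\<open>ex_subseq_root_tendsto\<close> needs monotonicity for every index of
      the sequence, so the sequences \<open>T\<close> are confined to an interval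
      \<open>(0, b)\<close> where it always holds.\<close>
    from mono_ev obtain b where b: "b > 0" "\<And>t. 0 < t \<Longrightarrow> t < b \<Longrightarrow> mono_on {..n} ((!) (eigvals (At t)))"
      by (auto simp: eventually_at_right_field)
    show "((\<lambda>t. eigvals (At t) ! k) \<longlongrightarrow> eigvals A ! k) ?F"
    proof (rule tendsto_at_right_sequentially[OF b(1)])
      fix T :: "nat \<Rightarrow> real"
      assume T: "\<And>j. 0 < T j" "\<And>j. T j < b" "T \<longlonglongrightarrow> 0"
      show "(\<lambda>j. eigvals (At (T j)) ! k) \<longlonglongrightarrow> eigvals A ! k"
      proof (rule LIMSEQ_via_subsequences)
        fix s :: "nat \<Rightarrow> nat" assume s: "strict_mono s"
        have "filterlim T ?F sequentially"
          using T(3) less_imp_neq[OF T(1)] T(1) by (auto simp: filterlim_at intro!: always_eventually)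
        then have Ts: "filterlim (\<lambda>j. T (s j)) ?F sequentially"
          by (rule filterlim_compose) (rule filterlim_subseq[OF s])
        show "\<exists>r. strict_mono r \<and> (\<lambda>j. eigvals (At (T (s (r j)))) ! k) \<longlonglongrightarrow> eigvals A ! k"
          using b T k filterlim_compose[OF top Ts] filterlim_compose[OF lim Ts] mono_on_eigvals[OF A]
          by (intro ex_subseq_root_tendsto[where L = "\<lambda>j i. eigvals (At (T (s j))) ! i"
              and c = "\<lambda>j. - ((T (s j))\<^sup>2)"]) auto
      qed
    qed
  qed
qed

end
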